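(* Let $x^{k+1}=x^{k}+t_{k}d^{k}$, where $d^{k}$ is the minimizer of $$\min_{d\in\mathbb{R}^{n}}\max_{i\in[m]}\left\{\frac{\langle\nabla f_{i}(x^{k}),d\rangle+g_{i}(x^{k}+d)-g_{i}(x^{k})}{\alpha_{i}^{k}}+\frac12\|d\|_{B_{k}}^{2}\right\},$$ with $\alpha^{k}\in\mathbb{R}^{m}_{++}$ and $B_{k}$ symmetric positive definite. Let $\lambda^{k}\in\Delta_m$ be the associated optimal dual multiplier and $s_k:=x^{k+1}-x^k$. Suppose that: (a) $\{x^{k}\}$ converges to some Pareto solution $x^{*}$ and $F(x^{*})\preceq F(x^{k})$ for all $k$; (b) $t_{k}=1$ for all sufficiently large $k$; (c) $\left\{\sum_{i\in[m]}\frac{\lambda^{k}_{i}}{\alpha^{k}_{i}}\right\}$ is bounded; (d) $a I\preceq\lim_{k\to\infty}\nabla^{2}f_{\lambda^{k}/\alpha^{k}}(x^{*})\preceq bI$ for some constants $b\ge a>0$; (e) $\lim_{k\to\infty}\nabla^{2}f_{i}(x^{k})=\nabla^{2}f_{i}(x^{*})$ for all $i\in[m]$; (f) $\displaystyle\lim_{k\to\infty}\frac{\left\|\left(B_{k}-\nabla^{2}f_{\lambda^{k}/\alpha^{k}}(x^{k})\right)s_{k}\right\|}{\|s_{k}\|}=0$. Then $\{x^{k}\}$ converges to $x^{*}$ superlinearly, i.e. $\lim_{k\to\infty}\frac{\|x^{k+1}-x^*\|}{\|x^k-x^*\|}=0$.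
   Context: Setting: $F=(F_1,\dots,F_m)$ with $F_i=f_i+g_i$ on $\mathbb{R}^n$, where each $f_i:\mathbb{R}^n\to\mathbb{R}$ is twice continuously differentiable and each $g_i:\mathbb{R}^n\to\mathbb{R}\cup\{+\infty\}$ is proper, convex and lower semicontinuous; all $x^k$ lie in $\bigcap_{i}\mathrm{dom}(g_i)$. $[m]=\{1,\dots,m\}$, $\Delta_m$ is the unit simplex $\{\lambda:\sum_i\lambda_i=1,\lambda_i\ge0\}$. Order: for vectors, $u\preceq v$ means $v-u\in\mathbb{R}^m_+$; for symmetric matrices, $U\preceq V$ means $V-U$ is positive semidefinite. $\|d\|_B=\sqrt{\langle d,Bd\rangle}$; $\|\cdot\|$ is the Euclidean norm. A point $x^*$ is a Pareto solution if there is no $x$ with $F(x)\preceq F(x^* )$ and $F(x)\ne F(x^* )$. Notation: $\lambda/\alpha:=(\lambda_1/\alpha_1,\dots,\lambda_m/\alpha_m)$; for a weight vector $w\in\mathbb{R}^m_+$, $f_w:=\sum_i w_if_i$, $g_w:=\sum_i w_ig_i$, $\nabla f_w:=\sum_i w_i\nabla f_i$, $\nabla^2 f_w:=\sum_iw_i\nabla^2f_i$ (with $g_w(x)=+\infty$ whenever some $g_i(x)=+\infty$). Dual multiplier: $\lambda^k\in\Delta_m$ is an optimal solution of the dual problem $$\max_{\lambda\in\Delta_m}\min_{d\in\mathbb{R}^n}\left\{\langle\nabla f_{\lambda/\alpha^k}(x^k),d\rangle+g_{\lambda/\alpha^k}(x^k+d)-g_{\lambda/\alpha^k}(x^k)+\tfrac12\|d\|_{B_k}^2\right\},$$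 and $d^k$ is the minimizer of the inner problem for $\lambda=\lambda^k$; equivalently $-\nabla f_{\lambda^k/\alpha^k}(x^k)-B_kd^k\in\partial g_{\lambda^k/\alpha^k}(x^k+d^k)$. The sequence is infinite with $d^k\neq0$ (the method stops when $d^k=0$), $t_k\in(0,1]$, so that the quotients above are defined. *)

theory Defs
  imports "HOL-Analysis.Analysis"
begin

definition gradient :: "('a::real_inner \<Rightarrow> real) \<Rightarrow> 'a \<Rightarrow> 'a" where
  "gradient f x = (THE D. GDERIV f x :> D)"

definition hessian :: "(real^'n \<Rightarrow> real) \<Rightarrow> real^'n \<Rightarrow> real^'n^'n" where
  "hessian f x = jacobian (gradient f) (at x)"

definition twice_continuously_differentiable :: "(real^'n \<Rightarrow> real) \<Rightarrow> bool" where
  "twice_continuously_differentiable f \<longleftrightarrow>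
     (\<forall>x. f differentiable (at x)) \<and>
     (\<forall>x. gradient f differentiable (at x)) \<and>
     continuous_on UNIV (hessian f)"

text \<open>
  A function with values in the reals extended by \<open>\<infinity>\<close> is an \<open>ereal\<close>-valued function that never
  takes the value \<open>-\<infinity>\<close>; this is part of \<open>proper_fun\<close>. For such functions the inequality in
  \<open>convex_fun\<close> involves no indeterminate sum; at the end points \<open>t = 0, 1\<close> it is trivial, since
  \<open>0 * \<infinity> = 0\<close> in \<open>ereal\<close>.
\<close>

definition proper_fun :: "('a \<Rightarrow> ereal) \<Rightarrow> bool" where
  "proper_fun g \<longleftrightarrow> (\<forall>x. g x \<noteq> -\<infinity>) \<and> (\<exists>x. g x \<noteq> \<infinity>)"

definition convex_fun :: "('a::real_vector \<Rightarrow> ereal) \<Rightarrow> bool" where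
  "convex_fun g \<longleftrightarrow>
     (\<forall>x y. \<forall>t\<in>{0..1}. g ((1 - t) *\<^sub>R x + t *\<^sub>R y) \<le> ereal (1 - t) * g x + ereal t * g y)"

definition lsc_fun :: "('a::topological_space \<Rightarrow> ereal) \<Rightarrow> bool" where
  "lsc_fun g \<longleftrightarrow> (\<forall>x. g x \<le> Liminf (at x) g)"

definition effective_domain :: "('a \<Rightarrow> ereal) \<Rightarrow> 'a set" where
  "effective_domain g = {x. g x < \<infinity>}"

definition positive_semidefinite :: "real^'n^'n \<Rightarrow> bool" where
  "positive_semidefinite A \<longleftrightarrow> transpose A = A \<and> (\<forall>v. 0 \<le> v \<bullet> (A *v v))"

definition positive_definite :: "real^'n^'n \<Rightarrow> bool" where
  "positive_definite A \<longleftrightarrow> transpose A = A \<and> (\<forall>v. v \<noteq> 0 \<longrightarrow> 0 < v \<bullet> (A *v v))"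

definition loewner_le :: "real^'n^'n \<Rightarrow> real^'n^'n \<Rightarrow> bool" (infix "\<preceq>\<^sub>L" 50) where
  "U \<preceq>\<^sub>L V \<longleftrightarrow> positive_semidefinite (V - U)"

definition norm_mat :: "real^'n^'n \<Rightarrow> real^'n \<Rightarrow> real" where
  "norm_mat B d = sqrt (d \<bullet> (B *v d))"

text \<open>
  The vector-valued objective. Its values are functions on the index type \<open>'m\<close>, so that the
  library order \<open>\<le>\<close> on them is the componentwise one.
\<close>

definition objective ::
    "('m \<Rightarrow> 'a \<Rightarrow> real) \<Rightarrow> ('m \<Rightarrow> 'a \<Rightarrow> ereal) \<Rightarrow> 'a \<Rightarrow> 'm \<Rightarrow> ereal" where
  "objective f g x = (\<lambda>i. ereal (f i x) + g i x)"

definition pareto_solution :: "('a \<Rightarrow> 'b::order) \<Rightarrow> 'a \<Rightarrow> bool" where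
  "pareto_solution F xs \<longleftrightarrow> \<not> (\<exists>x. F x \<le> F xs \<and> F x \<noteq> F xs)"

definition unit_simplex :: "(real^'m) set" where
  "unit_simplex = {l. (\<Sum>i\<in>UNIV. l $ i) = 1 \<and> (\<forall>i. 0 \<le> l $ i)}"

definition vec_divide :: "real^'m \<Rightarrow> real^'m \<Rightarrow> real^'m" where
  "vec_divide l \<alpha> = (\<chi> i. l $ i / \<alpha> $ i)"

definition weighted_gradient ::
    "('m \<Rightarrow> real^'n \<Rightarrow> real) \<Rightarrow> real^'m \<Rightarrow> real^'n \<Rightarrow> real^'n" where
  "weighted_gradient f w x = (\<Sum>i\<in>UNIV. w $ i *\<^sub>R gradient (f i) x)"

definition weighted_hessian ::
    "('m \<Rightarrow> real^'n \<Rightarrow> real) \<Rightarrow> real^'m \<Rightarrow> real^'n \<Rightarrow> real^'n^'n" where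
  "weighted_hessian f w x = (\<Sum>i\<in>UNIV. w $ i *\<^sub>R hessian (f i) x)"

text \<open>
  The case distinction is needed because \<open>0 * \<infinity> = 0\<close> in \<open>ereal\<close>, whereas a weighted sum is to be
  \<open>\<infinity>\<close> as soon as one of its terms is, even one of weight zero.
\<close>

definition weighted_g :: "('m::finite \<Rightarrow> 'a \<Rightarrow> ereal) \<Rightarrow> real^'m \<Rightarrow> 'a \<Rightarrow> ereal" where
  "weighted_g g w x =
     (if \<exists>i. g i x = \<infinity> then \<infinity> else (\<Sum>i\<in>UNIV. ereal (w $ i) * g i x))"

definition primal_objective ::
    "('m::finite \<Rightarrow> real^'n \<Rightarrow> real) \<Rightarrow> ('m \<Rightarrow> real^'n \<Rightarrow> ereal) \<Rightarrow> real^'m \<Rightarrow> real^'n^'n \<Rightarrow>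
     real^'n \<Rightarrow> real^'n \<Rightarrow> ereal" where
  "primal_objective f g \<alpha> B x d =
     (MAX i. (ereal (gradient (f i) x \<bullet> d) + g i (x + d) - g i x) / ereal (\<alpha> $ i)
             + ereal (1/2 * (norm_mat B d)\<^sup>2))"

definition inner_objective ::
    "('m::finite \<Rightarrow> real^'n \<Rightarrow> real) \<Rightarrow> ('m \<Rightarrow> real^'n \<Rightarrow> ereal) \<Rightarrow> real^'m \<Rightarrow> real^'n^'n \<Rightarrow>
     real^'n \<Rightarrow> real^'m \<Rightarrow> real^'n \<Rightarrow> ereal" where
  "inner_objective f g \<alpha> B x l d =
     ereal (weighted_gradient f (vec_divide l \<alpha>) x \<bullet> d)
     + weighted_g g (vec_divide l \<alpha>) (x + d) - weighted_g g (vec_divide l \<alpha>) x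
     + ereal (1/2 * (norm_mat B d)\<^sup>2)"

definition dual_objective ::
    "('m::finite \<Rightarrow> real^'n \<Rightarrow> real) \<Rightarrow> ('m \<Rightarrow> real^'n \<Rightarrow> ereal) \<Rightarrow> real^'m \<Rightarrow> real^'n^'n \<Rightarrow>
     real^'n \<Rightarrow> real^'m \<Rightarrow> ereal" where
  "dual_objective f g \<alpha> B x l = (INF d. inner_objective f g \<alpha> B x l d)"

definition subproblem_solution ::
    "('m::finite \<Rightarrow> real^'n \<Rightarrow> real) \<Rightarrow> ('m \<Rightarrow> real^'n \<Rightarrow> ereal) \<Rightarrow> real^'m \<Rightarrow> real^'n^'n \<Rightarrow>
     real^'n \<Rightarrow> real^'n \<Rightarrow> bool" where
  "subproblem_solution f g \<alpha> B x d \<longleftrightarrow>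
     is_arg_min (primal_objective f g \<alpha> B x) (\<lambda>_. True) d"

definition dual_multiplier ::
    "('m::finite \<Rightarrow> real^'n \<Rightarrow> real) \<Rightarrow> ('m \<Rightarrow> real^'n \<Rightarrow> ereal) \<Rightarrow> real^'m \<Rightarrow> real^'n^'n \<Rightarrow>
     real^'n \<Rightarrow> real^'n \<Rightarrow> real^'m \<Rightarrow> bool" where
  "dual_multiplier f g \<alpha> B x d l \<longleftrightarrow>
     is_arg_max (dual_objective f g \<alpha> B x) (\<lambda>l. l \<in> unit_simplex) l \<and>
     is_arg_min (inner_objective f g \<alpha> B x l) (\<lambda>_. True) d"

end

theory Submission
  imports Defs
begin

text \<open>
  Write \<open>w\<close> for the weights \<open>\<lambda>\<^sup>k / \<alpha>\<^sup>k\<close> and let \<open>k\<close> be so large that the step is a unit step, so that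
  \<open>d\<^sup>k = s\<^sub>k = x\<^sup>k\<^sup>+\<^sup>1 - x\<^sup>k\<close>. Optimality of \<open>d\<^sup>k\<close> for the scalarised subproblem, tested in the direction
  of \<open>x\<^sup>*\<close>, bounds \<open>g\<^sub>w(x\<^sup>k\<^sup>+\<^sup>1) - g\<^sub>w(x\<^sup>*)\<close> by \<open>\<langle>\<nabla>f\<^sub>w(x\<^sup>k) + B\<^sub>k s\<^sub>k, x\<^sup>* - x\<^sup>k\<^sup>+\<^sup>1\<rangle>\<close>
  (\<open>prox_newton_variational_inequality\<close>). As \<open>F(x\<^sup>*)\<close> lies below \<open>F(x\<^sup>k\<^sup>+\<^sup>1)\<close>, the same quantity
  bounds \<open>f\<^sub>w(x\<^sup>*) - f\<^sub>w(x\<^sup>k\<^sup>+\<^sup>1)\<close>. On the other hand \<open>\<nabla>\<^sup>2f\<^sub>w\<close> is close to \<open>H \<succeq> aI\<close> near \<open>x\<^sup>*\<close>, hence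
  \<open>f\<^sub>w(x\<^sup>*) - f\<^sub>w(x\<^sup>k\<^sup>+\<^sup>1)\<close> exceeds \<open>\<langle>\<nabla>f\<^sub>w(x\<^sup>k\<^sup>+\<^sup>1), x\<^sup>* - x\<^sup>k\<^sup>+\<^sup>1\<rangle>\<close> by a multiple of
  \<open>\<parallel>x\<^sup>* - x\<^sup>k\<^sup>+\<^sup>1\<parallel>\<^sup>2\<close> (\<open>quadratic_growth_of_approximately_linear_gradient\<close>). Comparing both,
  \<open>\<parallel>x\<^sup>k\<^sup>+\<^sup>1 - x\<^sup>*\<parallel>\<close> is at most a constant times the residual
  \<open>\<parallel>\<nabla>f\<^sub>w(x\<^sup>k) + B\<^sub>k s\<^sub>k - \<nabla>f\<^sub>w(x\<^sup>k\<^sup>+\<^sup>1)\<parallel>\<close>.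

  The residual is \<open>o(\<parallel>s\<^sub>k\<parallel>)\<close>: both \<open>B\<^sub>k s\<^sub>k\<close> and \<open>\<nabla>f\<^sub>w(x\<^sup>k\<^sup>+\<^sup>1) - \<nabla>f\<^sub>w(x\<^sup>k)\<close> differ from \<open>H s\<^sub>k\<close> by
  \<open>o(\<parallel>s\<^sub>k\<parallel>)\<close>, the first by the Dennis--More condition and the second by strict differentiability of
  the gradients at \<open>x\<^sup>*\<close>, which is uniform in \<open>k\<close> because the weights are bounded. Finally,
  \<open>\<parallel>s\<^sub>k\<parallel> \<le> \<parallel>x\<^sup>k\<^sup>+\<^sup>1 - x\<^sup>*\<parallel> + \<parallel>x\<^sup>k - x\<^sup>*\<parallel>\<close> turns \<open>\<parallel>x\<^sup>k\<^sup>+\<^sup>1 - x\<^sup>*\<parallel> = o(\<parallel>s\<^sub>k\<parallel>)\<close> into superlinear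
  convergence (\<open>superlinear_if_error_little_o_step\<close>).
\<close>

section \<open>Matrices and weighted sums\<close>

lemma bounded_bilinear_matrix_vector_mult:
  "bounded_bilinear ((*v) :: real^'n^'m \<Rightarrow> real^'n \<Rightarrow> real^'m)"
proof -
  have "linear (\<lambda>A :: real^'n^'m. A *v v)" for v
    by (intro linearI) (simp_all add: matrix_vector_mult_add_rdistrib scaleR_matrix_vector_assoc)
  then have "bilinear ((*v) :: real^'n^'m \<Rightarrow> real^'n \<Rightarrow> real^'m)"
    by (simp add: bilinear_def)
  then show ?thesis
    by (simp add: bilinear_conv_bounded_bilinear)
qed

lemma mat_mult_vector: "mat c *v v = c *\<^sub>R (v :: real^'n)"
  by (vector matrix_vector_mult_def mat_def) (simp add: if_distrib if_distribR cong: if_cong)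

lemma loewner_lower_bound_quadratic_form:
  assumes "mat a \<preceq>\<^sub>L H"
  shows "a * (norm v)\<^sup>2 \<le> v \<bullet> (H *v v)"
proof -
  have "0 \<le> v \<bullet> ((H - mat a) *v v)"
    using assms by (simp add: loewner_le_def positive_semidefinite_def)
  then show ?thesis
    by (simp add: matrix_vector_mult_diff_rdistrib mat_mult_vector inner_diff_right
        power2_norm_eq_inner)
qed

lemma norm_weighted_sum_le:
  fixes v :: "'i \<Rightarrow> 'a::real_normed_vector"
  assumes "\<And>i. i \<in> I \<Longrightarrow> 0 \<le> w i" "\<And>i. i \<in> I \<Longrightarrow> norm (v i) \<le> C"
    and "sum w I \<le> M" "0 \<le> C"
  shows "norm (\<Sum>i\<in>I. w i *\<^sub>R v i) \<le> M * C"
proof -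
  have "norm (\<Sum>i\<in>I. w i *\<^sub>R v i) \<le> (\<Sum>i\<in>I. w i * C)"
    using assms(1,2) by (intro sum_norm_le) (simp add: mult_left_mono)
  also have "\<dots> = sum w I * C"
    by (simp add: sum_distrib_right)
  finally show ?thesis
    using mult_right_mono[OF assms(3,4)] by linarith
qed

section \<open>First and second derivatives\<close>

lemma GDERIV_gradient:
  fixes f :: "'a::euclidean_space \<Rightarrow> real"
  assumes "f differentiable (at x)"
  shows "GDERIV f x :> gradient f x"
proof -
  obtain f' where f': "(f has_derivative f') (at x)"
    using assms by (auto simp: differentiable_def)
  have "f' = (\<lambda>h. h \<bullet> adjoint f' 1)"
    using adjoint_works[OF has_derivative_linear[OF f'], of _ 1] by auto
  then have ex: "GDERIV f x :> adjoint f' 1"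
    using f' by (simp add: gderiv_def)
  have "D = D'" if "GDERIV f x :> D" "GDERIV f x :> D'" for D D'
    using has_derivative_unique[OF that[unfolded gderiv_def]]
    by (metis vector_eq_rdot inner_commute)
  with ex show ?thesis
    unfolding gradient_def by (metis theI)
qed

lemma has_derivative_gradient:
  assumes "twice_continuously_differentiable f"
  shows "(gradient f has_derivative ((*v) (hessian f x))) (at x)"
  using assms unfolding twice_continuously_differentiable_def hessian_def
  by (metis jacobian_works)

lemma has_derivative_weighted_sum:
  assumes "\<And>i. twice_continuously_differentiable (f i)"
  shows "((\<lambda>y. \<Sum>i\<in>UNIV. w $ i * f i y) has_derivative
           (\<lambda>h. weighted_gradient f w x \<bullet> h)) (at x)"
proof -
  have "(f i has_derivative (\<lambda>h. h \<bullet> gradient (f i) x)) (at x)" for i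
    using GDERIV_gradient[of "f i" x] assms[of i]
    by (simp add: twice_continuously_differentiable_def gderiv_def)
  then have "((\<lambda>y. \<Sum>i\<in>UNIV. w $ i * f i y) has_derivative
       (\<lambda>h. \<Sum>i\<in>UNIV. w $ i * (h \<bullet> gradient (f i) x))) (at x)"
    by (intro has_derivative_sum has_derivative_mult_right)
  then show ?thesis
    unfolding weighted_gradient_def inner_sum_left inner_scaleR_left by (simp only: inner_commute)
qed

text \<open>
  Continuity of the Hessian upgrades differentiability of the gradient to strict differentiability:
  both points may vary, which matters since \<open>x\<^sup>k\<close> and \<open>x\<^sup>k\<^sup>+\<^sup>1\<close> both differ from the limit point.
\<close>

lemma gradient_strictly_differentiable:
  assumes f: "twice_continuously_differentiable f" and "0 < \<epsilon>"
  shows "\<exists>\<delta>>0. \<forall>y\<in>ball p \<delta>. \<forall>z\<in>ball p \<delta>.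
           norm (gradient f z - gradient f y - hessian f p *v (z - y)) \<le> \<epsilon> * norm (z - y)"
proof -
  obtain K where K: "0 < K"
    "\<And>(A :: real^'a^'a) v. norm (A *v v) \<le> norm A * norm v * K"
    using bounded_bilinear.pos_bounded[OF bounded_bilinear_matrix_vector_mult] by blast
  have "continuous (at p) (hessian f)"
    using f by (simp add: twice_continuously_differentiable_def continuous_on_eq_continuous_at)
  then obtain \<delta> where \<delta>: "0 < \<delta>" "\<And>y. dist y p < \<delta> \<Longrightarrow> dist (hessian f y) (hessian f p) < \<epsilon> / K"
    using \<open>0 < \<epsilon>\<close> K(1) by (metis continuous_at_eps_delta divide_pos_pos)
  have bound: "onorm ((*v) (hessian f y) - (*v) (hessian f p)) \<le> \<epsilon>" if "y \<in> ball p \<delta>" for y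
  proof (rule onorm_bound)
    fix v
    have "dist y p < \<delta>"
      using that by (simp add: dist_commute)
    then have le: "norm (hessian f y - hessian f p) * K \<le> \<epsilon>"
      using \<delta>(2)[of y] K(1) by (simp add: dist_norm pos_less_divide_eq)
    have "((*v) (hessian f y) - (*v) (hessian f p)) v = (hessian f y - hessian f p) *v v"
      by (simp add: matrix_vector_mult_diff_rdistrib)
    also have "norm \<dots> \<le> norm (hessian f y - hessian f p) * K * norm v"
      using K(2)[of "hessian f y - hessian f p" v] by (simp add: mult.commute mult.left_commute)
    also have "\<dots> \<le> \<epsilon> * norm v"
      using le by (simp add: mult_right_mono)
    finally show "norm (((*v) (hessian f y) - (*v) (hessian f p)) v) \<le> \<epsilon> * norm v" .
  qed (use \<open>0 < \<epsilon>\<close> in simp)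
  have "norm (gradient f z - gradient f y - hessian f p *v (z - y)) \<le> norm (z - y) * \<epsilon>"
    if yz: "y \<in> ball p \<delta>" "z \<in> ball p \<delta>" for y z
  proof (rule differentiable_bound_linearization[where S = "ball p \<delta>" and ?x0.0 = p
        and f' = "\<lambda>u. (*v) (hessian f u)"])
    show "y + t *\<^sub>R (z - y) \<in> ball p \<delta>" if "t \<in> {0..1}" for t
      using convexD_alt[OF convex_ball yz] that by (simp add: algebra_simps)
    show "(gradient f has_derivative (*v) (hessian f u)) (at u within ball p \<delta>)" for u
      using has_derivative_gradient[OF f] by (rule has_derivative_at_withinI)
  qed (use bound \<delta>(1) in auto)
  then show ?thesis
    using \<delta>(1) by (metis mult.commute)
qed

text \<open>
  The modulus of strict differentiability survives nonnegative combinations of bounded total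
  weight, so one neighbourhood serves all weights; this is what makes the estimate uniform in \<open>k\<close>.
\<close>

lemma weighted_gradient_strictly_differentiable:
  fixes f :: "'m::finite \<Rightarrow> real^'n \<Rightarrow> real"
  assumes f: "\<And>i. twice_continuously_differentiable (f i)" and "0 < \<epsilon>"
  shows "\<exists>\<delta>>0. \<forall>w. (\<forall>i. 0 \<le> w $ i) \<longrightarrow> (\<Sum>i\<in>UNIV. w $ i) \<le> M \<longrightarrow>
           (\<forall>y\<in>ball p \<delta>. \<forall>z\<in>ball p \<delta>.
             norm (weighted_gradient f w z - weighted_gradient f w y
                   - weighted_hessian f w p *v (z - y)) \<le> \<epsilon> * norm (z - y))"
proof -
  \<comment> \<open>The constant \<open>\<bar>M\<bar> + 1\<close> keeps the divisor positive for every \<open>M\<close>.\<close>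
  define \<eta> where "\<eta> = \<epsilon> / (\<bar>M\<bar> + 1)"
  have \<eta>: "0 < \<eta>" "(\<bar>M\<bar> + 1) * \<eta> = \<epsilon>"
    using \<open>0 < \<epsilon>\<close> by (auto simp: \<eta>_def)
  obtain \<delta> where \<delta>: "\<And>i. 0 < \<delta> i" "\<And>i y z. y \<in> ball p (\<delta> i) \<Longrightarrow> z \<in> ball p (\<delta> i) \<Longrightarrow>
      norm (gradient (f i) z - gradient (f i) y - hessian (f i) p *v (z - y)) \<le> \<eta> * norm (z - y)"
    using gradient_strictly_differentiable[OF f \<eta>(1)] by metis
  define r where "r = Min (range \<delta>)"
  have r: "0 < r" "\<And>i. r \<le> \<delta> i"
    using \<delta>(1) by (auto simp: r_def)
  have "norm (weighted_gradient f w z - weighted_gradient f w y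
              - weighted_hessian f w p *v (z - y)) \<le> \<epsilon> * norm (z - y)"
    if w: "\<And>i. 0 \<le> w $ i" "(\<Sum>i\<in>UNIV. w $ i) \<le> M" and yz: "y \<in> ball p r" "z \<in> ball p r"
    for w y z
  proof -
    interpret mv: bounded_bilinear "(*v) :: real^'n^'n \<Rightarrow> real^'n \<Rightarrow> real^'n"
      by (rule bounded_bilinear_matrix_vector_mult)
    have "weighted_gradient f w z - weighted_gradient f w y - weighted_hessian f w p *v (z - y)
        = (\<Sum>i\<in>UNIV. w $ i *\<^sub>R
            (gradient (f i) z - gradient (f i) y - hessian (f i) p *v (z - y)))"
      by (simp only: weighted_gradient_def weighted_hessian_def mv.sum_left mv.scaleR_left
          scaleR_diff_right sum_subtractf)
    also have "norm \<dots> \<le> (\<bar>M\<bar> + 1) * (\<eta> * norm (z - y))"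
    proof (rule norm_weighted_sum_le)
      fix i
      have "y \<in> ball p (\<delta> i)" "z \<in> ball p (\<delta> i)"
        using yz r(2)[of i] by auto
      then show "norm (gradient (f i) z - gradient (f i) y - hessian (f i) p *v (z - y))
          \<le> \<eta> * norm (z - y)"
        by (rule \<delta>(2))
    qed (use w \<eta>(1) in auto)
    also have "\<dots> = \<epsilon> * norm (z - y)"
      using \<eta>(2) by (metis mult.assoc)
    finally show ?thesis .
  qed
  with r(1) show ?thesis
    by blast
qed

text \<open>
  Second-order Taylor expansion without second derivatives: the mean value theorem is applied to
  the difference between the function along the segment and its quadratic model, whose derivative
  is the linearisation error of the gradient.
\<close>

lemma quadratic_growth_of_approximately_linear_gradient:
  fixes \<phi> :: "real^'n \<Rightarrow> real" and H :: "real^'n^'n"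
  assumes der: "\<And>u. (\<phi> has_derivative (\<lambda>h. G u \<bullet> h)) (at u)"
    and S: "convex S" "y \<in> S" "z \<in> S"
    and approx: "\<And>u. u \<in> S \<Longrightarrow> norm (G u - G y - H *v (u - y)) \<le> \<epsilon> * norm (u - y)"
    and coercive: "\<And>v. a * (norm v)\<^sup>2 \<le> v \<bullet> (H *v v)"
    and "0 \<le> \<epsilon>"
  shows "G y \<bullet> (z - y) + (a / 2 - \<epsilon>) * (norm (z - y))\<^sup>2 \<le> \<phi> z - \<phi> y"
proof -
  define e where "e = z - y"
  define \<psi> where "\<psi> s = \<phi> (y + s *\<^sub>R e) - s * (G y \<bullet> e) - s\<^sup>2 / 2 * (e \<bullet> (H *v e))" for s
  define \<psi>' where "\<psi>' s = (G (y + s *\<^sub>R e) - G y - H *v (s *\<^sub>R e)) \<bullet> e" for s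
  have "(\<psi> has_real_derivative \<psi>' s) (at s)" for s
  proof -
    have "((\<lambda>s. y + s *\<^sub>R e) has_derivative (\<lambda>h. h *\<^sub>R e)) (at s)"
      by (auto intro!: derivative_eq_intros)
    then have "((\<lambda>s. \<phi> (y + s *\<^sub>R e)) has_derivative (\<lambda>h. G (y + s *\<^sub>R e) \<bullet> (h *\<^sub>R e))) (at s)"
      using has_derivative_compose der by blast
    then have "((\<lambda>s. \<phi> (y + s *\<^sub>R e)) has_real_derivative G (y + s *\<^sub>R e) \<bullet> e) (at s)"
      by (simp add: has_field_derivative_def mult_commute_abs)
    then have "(\<psi> has_real_derivative
        G (y + s *\<^sub>R e) \<bullet> e - G y \<bullet> e - s * (e \<bullet> (H *v e))) (at s)"
      unfolding \<psi>_def by (auto intro!: derivative_eq_intros)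
    then show ?thesis
      unfolding \<psi>'_def inner_diff_left matrix_vector_mult_scaleR inner_scaleR_left
      by (simp only: inner_commute)
  qed
  then obtain s where s: "0 < s" "s < 1" "\<psi> 1 - \<psi> 0 = \<psi>' s"
    using MVT2[of 0 1 \<psi> \<psi>'] by auto
  have "y + s *\<^sub>R e \<in> S"
    using convexD_alt[OF S, of s] s(1,2) by (simp add: e_def algebra_simps)
  then have "norm (G (y + s *\<^sub>R e) - G y - H *v (s *\<^sub>R e)) \<le> \<epsilon> * (s * norm e)"
    using approx[of "y + s *\<^sub>R e"] s(1) by simp
  also have "\<dots> \<le> \<epsilon> * norm e"
    using s(1,2) \<open>0 \<le> \<epsilon>\<close> by (intro mult_left_mono) (auto simp: mult_left_le_one_le)
  finally have "norm (G (y + s *\<^sub>R e) - G y - H *v (s *\<^sub>R e)) * norm e \<le> \<epsilon> * norm e * norm e"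
    by (rule mult_right_mono) simp
  with Cauchy_Schwarz_ineq2 have "\<bar>\<psi>' s\<bar> \<le> \<epsilon> * norm e * norm e"
    unfolding \<psi>'_def by (rule order_trans)
  then have "\<bar>\<psi>' s\<bar> \<le> \<epsilon> * (norm e)\<^sup>2"
    by (simp add: power2_eq_square mult.assoc)
  then have "- (\<epsilon> * (norm e)\<^sup>2) \<le> \<phi> z - G y \<bullet> e - (e \<bullet> (H *v e)) / 2 - \<phi> y"
    using s(3) by (simp add: \<psi>_def e_def)
  with coercive[of e] show ?thesis
    unfolding e_def[symmetric] by (simp add: algebra_simps)
qed

section \<open>Extended-valued convex functions and the subproblem\<close>

lemma proper_fun_real_of_ereal:
  assumes "proper_fun g" "y \<in> effective_domain g"
  shows "ereal (real_of_ereal (g y)) = g y"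
  using assms by (cases "g y") (auto simp: proper_fun_def effective_domain_def)

lemma convex_on_effective_domain:
  assumes g: "proper_fun g" "convex_fun g"
  shows "convex_on (effective_domain g) (\<lambda>y. real_of_ereal (g y))"
proof -
  have le: "g ((1 - t) *\<^sub>R y + t *\<^sub>R z) \<le>
      ereal ((1 - t) * real_of_ereal (g y) + t * real_of_ereal (g z))"
    if "y \<in> effective_domain g" "z \<in> effective_domain g" "0 \<le> t" "t \<le> 1" for y z t
  proof -
    have "g ((1 - t) *\<^sub>R y + t *\<^sub>R z) \<le> ereal (1 - t) * g y + ereal t * g z"
      using g(2) that by (simp add: convex_fun_def)
    also have "\<dots> = ereal ((1 - t) * real_of_ereal (g y) + t * real_of_ereal (g z))"
      using proper_fun_real_of_ereal[OF g(1) that(1)] proper_fun_real_of_ereal[OF g(1) that(2)]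
      by (metis plus_ereal.simps(1) times_ereal.simps(1))
    finally show ?thesis .
  qed
  have dom: "(1 - t) *\<^sub>R y + t *\<^sub>R z \<in> effective_domain g"
    if "y \<in> effective_domain g" "z \<in> effective_domain g" "0 \<le> t" "t \<le> 1" for y z t
    using le[OF that] by (auto simp: effective_domain_def)
  show ?thesis
  proof (rule convex_onI)
    show "convex (effective_domain g)"
      using dom by (simp add: convex_alt)
    show "real_of_ereal (g ((1 - t) *\<^sub>R y + t *\<^sub>R z)) \<le>
        (1 - t) * real_of_ereal (g y) + t * real_of_ereal (g z)"
      if "0 < t" "t < 1" "y \<in> effective_domain g" "z \<in> effective_domain g" for t y z
      using le[of y z t] dom[of y z t] proper_fun_real_of_ereal[OF g(1)] that
      by (metis ereal_less_eq(3) less_imp_le)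
  qed
qed

lemma weighted_g_eq_real:
  fixes g :: "'m::finite \<Rightarrow> 'a \<Rightarrow> ereal"
  assumes "\<And>i. proper_fun (g i)" "y \<in> (\<Inter>i. effective_domain (g i))"
  shows "weighted_g g w y = ereal (\<Sum>i\<in>UNIV. w $ i * real_of_ereal (g i y))"
proof -
  have "ereal (w $ i) * g i y = ereal (w $ i * real_of_ereal (g i y))" for i
    using proper_fun_real_of_ereal[of "g i" y] assms by (metis INT_E UNIV_I times_ereal.simps(1))
  moreover have "g i y \<noteq> \<infinity>" for i
    using assms(2) by (auto simp: effective_domain_def)
  ultimately show ?thesis
    by (simp add: weighted_g_def)
qed

lemma convex_on_weighted_real:
  fixes g :: "'m::finite \<Rightarrow> 'a::real_vector \<Rightarrow> ereal"
  assumes g: "\<And>i. proper_fun (g i)" "\<And>i. convex_fun (g i)" and w: "\<And>i. 0 \<le> w $ i"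
  shows "convex_on (\<Inter>i. effective_domain (g i)) (\<lambda>y. \<Sum>i\<in>UNIV. w $ i * real_of_ereal (g i y))"
proof (rule convex_onI)
  have cv: "convex_on (effective_domain (g i)) (\<lambda>y. real_of_ereal (g i y))" for i
    using convex_on_effective_domain g by blast
  show "convex (\<Inter>i. effective_domain (g i))"
    using cv by (intro convex_INT) (auto dest: convex_on_imp_convex)
  fix t :: real and y z
  assume *: "0 < t" "t < 1" "y \<in> (\<Inter>i. effective_domain (g i))" "z \<in> (\<Inter>i. effective_domain (g i))"
  have "(\<Sum>i\<in>UNIV. w $ i * real_of_ereal (g i ((1 - t) *\<^sub>R y + t *\<^sub>R z))) \<le>
      (\<Sum>i\<in>UNIV. w $ i * ((1 - t) * real_of_ereal (g i y) + t * real_of_ereal (g i z)))"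
    using * w convex_onD[OF cv] by (intro sum_mono mult_left_mono) auto
  also have "\<dots> = (1 - t) * (\<Sum>i\<in>UNIV. w $ i * real_of_ereal (g i y)) +
      t * (\<Sum>i\<in>UNIV. w $ i * real_of_ereal (g i z))"
    by (simp add: sum_distrib_left flip: sum.distrib) (simp add: algebra_simps)
  finally show "(\<Sum>i\<in>UNIV. w $ i * real_of_ereal (g i ((1 - t) *\<^sub>R y + t *\<^sub>R z))) \<le>
      (1 - t) * (\<Sum>i\<in>UNIV. w $ i * real_of_ereal (g i y)) +
      t * (\<Sum>i\<in>UNIV. w $ i * real_of_ereal (g i z))" .
qed

text \<open>
  The first-order condition \<open>- c - B (p - x) \<in> \<partial>\<gamma>(p)\<close> in variational form: minimality of \<open>p\<close> is
  compared with the point at fraction \<open>\<tau>\<close> of the way to \<open>z\<close>; dividing by \<open>\<tau>\<close> and letting \<open>\<tau>\<close> tend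
  to zero removes the quadratic term.
\<close>

lemma prox_newton_variational_inequality:
  fixes B :: "real^'n^'n" and \<gamma> :: "real^'n \<Rightarrow> real"
  assumes cv: "convex_on S \<gamma>" and pz: "p \<in> S" "z \<in> S" and sym: "transpose B = B"
    and min: "\<And>y. y \<in> S \<Longrightarrow>
      c \<bullet> (p - x) + \<gamma> p + 1/2 * ((p - x) \<bullet> (B *v (p - x))) \<le>
      c \<bullet> (y - x) + \<gamma> y + 1/2 * ((y - x) \<bullet> (B *v (y - x)))"
  shows "\<gamma> p - \<gamma> z \<le> (c + B *v (p - x)) \<bullet> (z - p)"
proof -
  define q where "q = (z - p) \<bullet> (B *v (z - p))"
  define R where "R = (c + B *v (p - x)) \<bullet> (z - p) + \<gamma> z - \<gamma> p"
  have "0 \<le> R + \<tau> * (q / 2)" if \<tau>: "0 < \<tau>" "\<tau> < 1" for \<tau>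
  proof -
    define y where "y = (1 - \<tau>) *\<^sub>R p + \<tau> *\<^sub>R z"
    have "y \<in> S"
      unfolding y_def using convex_on_imp_convex[OF cv] pz \<tau> by (simp add: convex_alt)
    have \<gamma>y: "\<gamma> y \<le> (1 - \<tau>) * \<gamma> p + \<tau> * \<gamma> z"
      unfolding y_def using convex_onD[OF cv] pz \<tau> by simp
    have yx: "y - x = (p - x) + \<tau> *\<^sub>R (z - p)"
      by (simp add: y_def algebra_simps)
    have Bsym: "(z - p) \<bullet> (B *v (p - x)) = (p - x) \<bullet> (B *v (z - p))"
      using sym by (metis dot_lmul_matrix inner_commute transpose_matrix_vector)
    have quad: "(y - x) \<bullet> (B *v (y - x)) =
        (p - x) \<bullet> (B *v (p - x)) + 2 * \<tau> * ((B *v (p - x)) \<bullet> (z - p)) + \<tau> * \<tau> * q"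
      unfolding yx q_def matrix_vector_right_distrib matrix_vector_mult_scaleR inner_add_left
        inner_add_right inner_scaleR_left inner_scaleR_right inner_commute[of "B *v (p - x)"] Bsym
      by (simp add: algebra_simps)
    have lin: "c \<bullet> (y - x) = c \<bullet> (p - x) + \<tau> * (c \<bullet> (z - p))"
      by (simp add: yx inner_add_right)
    have "0 \<le> \<tau> * (R + \<tau> * (q / 2))"
      using min[OF \<open>y \<in> S\<close>] \<gamma>y unfolding quad lin R_def inner_add_left
      by (simp add: algebra_simps)
    then show ?thesis
      using \<tau>(1) by (simp add: zero_le_mult_iff)
  qed
  then have "eventually (\<lambda>\<tau>. 0 \<le> R + \<tau> * (q / 2)) (at_right 0)"
    by (auto simp: eventually_at_right[of 0 1] intro!: exI[of _ 1])
  moreover have "((\<lambda>\<tau>. R + \<tau> * (q / 2)) \<longlongrightarrow> R + 0 * (q / 2)) (at_right 0)"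
    by (intro tendsto_intros)
  ultimately have "0 \<le> R + 0 * (q / 2)"
    by (metis tendsto_lowerbound trivial_limit_at_right_real)
  then show ?thesis
    by (simp add: R_def)
qed

lemma inner_minimizer_variational_inequality:
  fixes f :: "'m::finite \<Rightarrow> real^'n \<Rightarrow> real" and g :: "'m \<Rightarrow> real^'n \<Rightarrow> ereal"
  assumes g: "\<And>i. proper_fun (g i)" "\<And>i. convex_fun (g i)"
    and w: "\<And>i. 0 \<le> vec_divide l \<alpha> $ i"
    and B: "positive_definite B"
    and dom: "x \<in> (\<Inter>i. effective_domain (g i))" "x + d \<in> (\<Inter>i. effective_domain (g i))"
      "z \<in> (\<Inter>i. effective_domain (g i))"
    and min: "is_arg_min (inner_objective f g \<alpha> B x l) (\<lambda>_. True) d"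
  shows "(\<Sum>i\<in>UNIV. vec_divide l \<alpha> $ i * real_of_ereal (g i (x + d)))
         - (\<Sum>i\<in>UNIV. vec_divide l \<alpha> $ i * real_of_ereal (g i z))
         \<le> (weighted_gradient f (vec_divide l \<alpha>) x + B *v d) \<bullet> (z - (x + d))"
proof -
  define w where "w = vec_divide l \<alpha>"
  define c where "c = weighted_gradient f w x"
  define S where "S = (\<Inter>i. effective_domain (g i))"
  define \<gamma> where "\<gamma> y = (\<Sum>i\<in>UNIV. w $ i * real_of_ereal (g i y))" for y
  have nm: "(norm_mat B v)\<^sup>2 = v \<bullet> (B *v v)" for v
  proof -
    have "0 \<le> v \<bullet> (B *v v)"
      using B by (cases "v = 0") (auto simp: positive_definite_def less_imp_le)
    then show ?thesis
      by (simp add: norm_mat_def)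
  qed
  have inner_eq: "inner_objective f g \<alpha> B x l (y - x) =
      ereal (c \<bullet> (y - x) + \<gamma> y - \<gamma> x + 1/2 * ((y - x) \<bullet> (B *v (y - x))))" if "y \<in> S" for y
    using weighted_g_eq_real[OF g(1), where w = w] that dom(1) nm
    by (simp add: inner_objective_def c_def w_def \<gamma>_def S_def)
  have "\<gamma> (x + d) - \<gamma> z \<le> (c + B *v (x + d - x)) \<bullet> (z - (x + d))"
  proof (rule prox_newton_variational_inequality[where S = S])
    show "convex_on S \<gamma>"
      unfolding S_def \<gamma>_def using g w by (intro convex_on_weighted_real) (auto simp: w_def)
    show "transpose B = B"
      using B by (simp add: positive_definite_def)
    show "c \<bullet> (x + d - x) + \<gamma> (x + d) + 1/2 * ((x + d - x) \<bullet> (B *v (x + d - x))) \<le>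
        c \<bullet> (y - x) + \<gamma> y + 1/2 * ((y - x) \<bullet> (B *v (y - x)))" if "y \<in> S" for y
    proof -
      have "inner_objective f g \<alpha> B x l (x + d - x) \<le> inner_objective f g \<alpha> B x l (y - x)"
        using min by (simp add: is_arg_min_linorder)
      then show ?thesis
        using dom(2) that unfolding S_def[symmetric] by (simp only: inner_eq ereal_less_eq)
    qed
  qed (use dom in \<open>auto simp: S_def\<close>)
  then show ?thesis
    by (simp add: \<gamma>_def w_def c_def)
qed

lemma objective_le_imp_weighted_le:
  fixes f :: "'m::finite \<Rightarrow> 'a \<Rightarrow> real" and g :: "'m \<Rightarrow> 'a \<Rightarrow> ereal"
  assumes g: "\<And>i. proper_fun (g i)" and w: "\<And>i. 0 \<le> w $ i"
    and le: "objective f g z \<le> objective f g y"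
    and y: "y \<in> (\<Inter>i. effective_domain (g i))"
  shows "z \<in> (\<Inter>i. effective_domain (g i))"
    and "(\<Sum>i\<in>UNIV. w $ i * f i z) + (\<Sum>i\<in>UNIV. w $ i * real_of_ereal (g i z)) \<le>
         (\<Sum>i\<in>UNIV. w $ i * f i y) + (\<Sum>i\<in>UNIV. w $ i * real_of_ereal (g i y))"
proof -
  have ley: "ereal (f i z) + g i z \<le> ereal (f i y) + ereal (real_of_ereal (g i y))" for i
    using le proper_fun_real_of_ereal[OF g, of y i] y by (simp add: objective_def le_fun_def)
  show z: "z \<in> (\<Inter>i. effective_domain (g i))"
  proof
    show "z \<in> effective_domain (g i)" for i
      using ley[of i] by (cases "g i z") (auto simp: effective_domain_def)
  qed
  have "f i z + real_of_ereal (g i z) \<le> f i y + real_of_ereal (g i y)" for i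
    using ley[of i] proper_fun_real_of_ereal[OF g, of z i] z
    by (metis INT_E UNIV_I ereal_less_eq(3) plus_ereal.simps(1))
  then have "(\<Sum>i\<in>UNIV. w $ i * (f i z + real_of_ereal (g i z))) \<le>
      (\<Sum>i\<in>UNIV. w $ i * (f i y + real_of_ereal (g i y)))"
    using w by (intro sum_mono mult_left_mono) auto
  then show "(\<Sum>i\<in>UNIV. w $ i * f i z) + (\<Sum>i\<in>UNIV. w $ i * real_of_ereal (g i z)) \<le>
         (\<Sum>i\<in>UNIV. w $ i * f i y) + (\<Sum>i\<in>UNIV. w $ i * real_of_ereal (g i y))"
    by (simp add: distrib_left sum.distrib)
qed

section \<open>Superlinear convergence\<close>

lemma superlinear_if_error_little_o_step:
  fixes x :: "nat \<Rightarrow> 'a::real_normed_vector"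
  assumes "\<And>\<epsilon>. 0 < \<epsilon> \<Longrightarrow>
    eventually (\<lambda>k. norm (x (Suc k) - p) \<le> \<epsilon> * norm (x (Suc k) - x k)) sequentially"
  shows "(\<lambda>k. norm (x (Suc k) - p) / norm (x k - p)) \<longlonglongrightarrow> 0"
proof (rule LIMSEQ_I)
  fix r :: real
  assume "0 < r"
  \<comment> \<open>With \<open>\<epsilon> \<le> 1/2\<close> the share of the new error in the step bound is absorbed on the left-hand side, at
    the price of a factor 2.\<close>
  define \<epsilon> where "\<epsilon> = min (1/2) (r/4)"
  have \<epsilon>: "0 < \<epsilon>" "\<epsilon> \<le> 1/2" "\<epsilon> \<le> r/4"
    using \<open>0 < r\<close> by (auto simp: \<epsilon>_def)
  obtain N where N: "\<And>k. N \<le> k \<Longrightarrow> norm (x (Suc k) - p) \<le> \<epsilon> * norm (x (Suc k) - x k)"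
    using assms[OF \<epsilon>(1)] by (auto simp: eventually_sequentially)
  have "norm (norm (x (Suc k) - p) / norm (x k - p) - 0) < r" if "N \<le> k" for k
  proof -
    have tri: "norm (x (Suc k) - x k) \<le> norm (x (Suc k) - p) + norm (x k - p)"
      using norm_triangle_ineq4[of "x (Suc k) - p" "x k - p"] by simp
    have "norm (x (Suc k) - p) \<le> \<epsilon> * norm (x (Suc k) - p) + \<epsilon> * norm (x k - p)"
      using N[OF that] mult_left_mono[OF tri, of \<epsilon>] \<epsilon>(1) by (simp add: distrib_left)
    moreover have "\<epsilon> * norm (x (Suc k) - p) \<le> 1/2 * norm (x (Suc k) - p)"
      "\<epsilon> * norm (x k - p) \<le> r/4 * norm (x k - p)"
      using \<epsilon> by (intro mult_right_mono; simp)+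
    ultimately have "norm (x (Suc k) - p) \<le> r/2 * norm (x k - p)"
      by simp
    then have "norm (x (Suc k) - p) / norm (x k - p) \<le> r/2"
      using \<open>0 < r\<close> by (cases "x k = p") (simp_all add: divide_le_eq)
    also have "r/2 < r"
      using \<open>0 < r\<close> by simp
    finally show ?thesis
      by simp
  qed
  then show "\<exists>no. \<forall>k\<ge>no. norm (norm (x (Suc k) - p) / norm (x k - p) - 0) < r"
    by blast
qed

text \<open>
  One step: the upper bound \<open>\<phi>(z) - \<phi>(y) \<le> v \<bullet> (z - y)\<close> against quadratic growth of \<open>\<phi>\<close> leaves
  \<open>(a/2 - \<epsilon>) \<parallel>z - y\<parallel>\<^sup>2 \<le> (v - \<nabla>\<phi>(y)) \<bullet> (z - y)\<close>.
\<close>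

lemma error_le_residual:
  fixes \<phi> :: "real^'n \<Rightarrow> real" and H :: "real^'n^'n"
  assumes der: "\<And>u. (\<phi> has_derivative (\<lambda>h. G u \<bullet> h)) (at u)"
    and S: "convex S" "y \<in> S" "z \<in> S"
    and approx: "\<And>u. u \<in> S \<Longrightarrow> norm (G u - G y - H *v (u - y)) \<le> \<epsilon> * norm (u - y)"
    and coercive: "\<And>v. a * (norm v)\<^sup>2 \<le> v \<bullet> (H *v v)"
    and "0 \<le> \<epsilon>"
    and upper: "\<phi> z - \<phi> y \<le> v \<bullet> (z - y)"
  shows "(a / 2 - \<epsilon>) * norm (z - y) \<le> norm (v - G y)"
proof (cases "z = y")
  case False
  have "(a / 2 - \<epsilon>) * (norm (z - y))\<^sup>2 \<le> (v - G y) \<bullet> (z - y)"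
    using quadratic_growth_of_approximately_linear_gradient[OF der S approx coercive \<open>0 \<le> \<epsilon>\<close>] upper
    by (simp add: inner_diff_left)
  also have "\<dots> \<le> norm (v - G y) * norm (z - y)"
    by (rule norm_cauchy_schwarz)
  finally show ?thesis
    using False by (simp add: power2_eq_square flip: mult.assoc)
qed simp

theorem theorem3p1:
  fixes f :: "'m::finite \<Rightarrow> real^'n \<Rightarrow> real"
    and g :: "'m \<Rightarrow> real^'n \<Rightarrow> ereal"
    and x d :: "nat \<Rightarrow> real^'n"
    and xs :: "real^'n"
    and t :: "nat \<Rightarrow> real"
    and \<alpha> l :: "nat \<Rightarrow> real^'m"
    and B :: "nat \<Rightarrow> real^'n^'n"
    and H :: "real^'n^'n"
    and a b :: real
  assumes f: "\<And>i. twice_continuously_differentiable (f i)"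
    and g: "\<And>i. proper_fun (g i)" "\<And>i. convex_fun (g i)" "\<And>i. lsc_fun (g i)"
    and x_dom: "\<And>k. x k \<in> (\<Inter>i. effective_domain (g i))"
    and alpha_pos: "\<And>k i. 0 < \<alpha> k $ i"
    and B_pd: "\<And>k. positive_definite (B k)"
    and d_primal: "\<And>k. subproblem_solution f g (\<alpha> k) (B k) (x k) (d k)"
    and d_nonzero: "\<And>k. d k \<noteq> 0"
    and l_dual: "\<And>k. dual_multiplier f g (\<alpha> k) (B k) (x k) (d k) (l k)"
    and t_range: "\<And>k. t k \<in> {0<..1}"
    and step: "\<And>k. x (Suc k) = x k + t k *\<^sub>R d k"
    and a_lim: "x \<longlonglongrightarrow> xs"
    and a_pareto: "pareto_solution (objective f g) xs"
    and a_below: "\<And>k. objective f g xs \<le> objective f g (x k)"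
    and b_unit: "eventually (\<lambda>k. t k = 1) sequentially"
    and c_bounded: "bounded (range (\<lambda>k. \<Sum>i\<in>UNIV. l k $ i / \<alpha> k $ i))"
    and d_lim: "(\<lambda>k. weighted_hessian f (vec_divide (l k) (\<alpha> k)) xs) \<longlonglongrightarrow> H"
    and d_const: "0 < a" "a \<le> b"
    and d_bounds: "mat a \<preceq>\<^sub>L H" "H \<preceq>\<^sub>L mat b"
    and e_hess: "\<And>i. (\<lambda>k. hessian (f i) (x k)) \<longlonglongrightarrow> hessian (f i) xs"
    and f_dennis_more:
      "(\<lambda>k. norm ((B k - weighted_hessian f (vec_divide (l k) (\<alpha> k)) (x k)) *v (x (Suc k) - x k))
            / norm (x (Suc k) - x k)) \<longlonglongrightarrow> 0"
  shows "(\<lambda>k. norm (x (Suc k) - xs) / norm (x k - xs)) \<longlonglongrightarrow> 0"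
proof (rule superlinear_if_error_little_o_step)
  fix \<epsilon>\<^sub>0 :: real
  assume "0 < \<epsilon>\<^sub>0"
  define w where "w k = vec_divide (l k) (\<alpha> k)" for k
  define G where "G k = weighted_gradient f (w k)" for k
  define s where "s k = x (Suc k) - x k" for k
  \<comment> \<open>With \<open>\<epsilon> \<le> a/4\<close> the growth constant \<open>a/2 - \<epsilon>\<close> is at least \<open>a/4\<close>; the residual below is at most
    \<open>2 \<epsilon> \<parallel>s\<^sub>k\<parallel>\<close>, so \<open>\<epsilon> \<le> a \<epsilon>\<^sub>0 / 8\<close> yields the factor \<open>\<epsilon>\<^sub>0\<close>.\<close>
  define \<epsilon> where "\<epsilon> = min (a / 4) (a * \<epsilon>\<^sub>0 / 8)"
  have \<epsilon>: "0 < \<epsilon>" "\<epsilon> \<le> a / 4" "\<epsilon> \<le> a * \<epsilon>\<^sub>0 / 8"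
    using \<open>0 < a\<close> \<open>0 < \<epsilon>\<^sub>0\<close> by (auto simp: \<epsilon>_def)
  obtain K where K: "0 < K" "\<And>(A :: real^'n^'n) v. norm (A *v v) \<le> norm A * norm v * K"
    using bounded_bilinear.pos_bounded[OF bounded_bilinear_matrix_vector_mult] by blast

  have w_nonneg: "0 \<le> w k $ i" for k i
    using l_dual[of k] alpha_pos[of k i]
    by (simp add: w_def vec_divide_def dual_multiplier_def is_arg_max_def unit_simplex_def)
  obtain M where M: "\<And>k. (\<Sum>i\<in>UNIV. w k $ i) \<le> M"
  proof -
    obtain M where "\<bar>\<Sum>i\<in>UNIV. w k $ i\<bar> \<le> M" for k
      using c_bounded by (auto simp: bounded_iff w_def vec_divide_def)
    then show thesis
      using that abs_le_D1 by blast
  qed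

  \<comment> \<open>The Dennis--More condition evaluates the Hessian at \<open>x\<^sup>k\<close>, the spectral bound at \<open>x\<^sup>*\<close>; bounded
    weights make the two weighted Hessians asymptotically equal.\<close>
  have lim_xs: "(\<lambda>k. weighted_hessian f (w k) xs) \<longlonglongrightarrow> H"
    using d_lim by (simp add: w_def)
  have "(\<lambda>k. weighted_hessian f (w k) (x k) - weighted_hessian f (w k) xs) \<longlonglongrightarrow> 0"
  proof (rule Lim_null_comparison)
    define D where "D k = (\<Sum>i\<in>UNIV. norm (hessian (f i) (x k) - hessian (f i) xs))" for k
    have "norm (weighted_hessian f (w k) (x k) - weighted_hessian f (w k) xs) \<le> M * D k" for k
    proof -
      have "weighted_hessian f (w k) (x k) - weighted_hessian f (w k) xs =
          (\<Sum>i\<in>UNIV. w k $ i *\<^sub>R (hessian (f i) (x k) - hessian (f i) xs))"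
        by (simp add: weighted_hessian_def scaleR_diff_right sum_subtractf)
      also have "norm \<dots> \<le> M * D k"
        using w_nonneg M unfolding D_def
        by (intro norm_weighted_sum_le sum_nonneg)
          (auto intro!: member_le_sum[where f = "\<lambda>i. norm (hessian (f i) (x k) - hessian (f i) xs)"])
      finally show ?thesis .
    qed
    then show "\<forall>\<^sub>F k in sequentially.
        norm (weighted_hessian f (w k) (x k) - weighted_hessian f (w k) xs) \<le> M * D k"
      by simp
    have "D \<longlonglongrightarrow> (\<Sum>i\<in>(UNIV::'m set). 0)"
      unfolding D_def using e_hess by (intro tendsto_sum tendsto_norm_zero LIM_zero) auto
    then show "(\<lambda>k. M * D k) \<longlonglongrightarrow> 0"
      by (intro tendsto_mult_right_zero) simp
  qed
  from tendsto_add[OF this lim_xs]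
  have lim_x: "(\<lambda>k. weighted_hessian f (w k) (x k)) \<longlonglongrightarrow> H"
    by simp

  have ev_B: "\<forall>\<^sub>F k in sequentially. norm (B k *v s k - H *v s k) \<le> \<epsilon> * norm (s k)"
  proof -
    have "\<forall>\<^sub>F k in sequentially. dist (weighted_hessian f (w k) (x k)) H < \<epsilon> / (2 * K)"
      using lim_x \<epsilon>(1) K(1) by (intro tendstoD) auto
    moreover have "\<forall>\<^sub>F k in sequentially.
        dist (norm ((B k - weighted_hessian f (w k) (x k)) *v s k) / norm (s k)) 0 < \<epsilon> / 2"
      using f_dennis_more \<epsilon>(1) unfolding w_def s_def by (intro tendstoD) auto
    ultimately show ?thesis
    proof eventually_elim
      case (elim k)
      define W where "W = weighted_hessian f (w k) (x k)"
      have "norm ((B k - W) *v s k) \<le> \<epsilon> / 2 * norm (s k)"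
        using elim(2) unfolding W_def[symmetric]
        by (cases "s k = 0") (auto simp: divide_less_eq less_imp_le)
      moreover have "norm ((W - H) *v s k) \<le> \<epsilon> / 2 * norm (s k)"
      proof -
        have "norm (W - H) * K \<le> \<epsilon> / 2"
          using elim(1) K(1) by (simp add: W_def dist_norm field_simps)
        then have "norm (W - H) * K * norm (s k) \<le> \<epsilon> / 2 * norm (s k)"
          by (rule mult_right_mono) simp
        then show ?thesis
          using K(2)[of "W - H" "s k"] by (simp add: mult.commute mult.left_commute)
      qed
      moreover have "B k *v s k - H *v s k = (B k - W) *v s k + (W - H) *v s k"
        by (simp add: matrix_vector_mult_diff_rdistrib)
      ultimately show ?case
        using norm_triangle_ineq[of "(B k - W) *v s k" "(W - H) *v s k"] by simp
    qed
  qed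

  obtain \<delta> where \<delta>: "0 < \<delta>" "\<And>k y z. y \<in> ball xs \<delta> \<Longrightarrow> z \<in> ball xs \<delta> \<Longrightarrow>
      norm (G k z - G k y - weighted_hessian f (w k) xs *v (z - y)) \<le> \<epsilon> / 2 * norm (z - y)"
  proof -
    have "0 < \<epsilon> / 2"
      using \<epsilon>(1) by simp
    from weighted_gradient_strictly_differentiable[where f = f and M = M and p = xs, OF f this]
      w_nonneg M that
    show thesis
      unfolding G_def by blast
  qed
  have ev_G: "\<forall>\<^sub>F k in sequentially. \<forall>y\<in>ball xs \<delta>. \<forall>z\<in>ball xs \<delta>.
      norm (G k z - G k y - H *v (z - y)) \<le> \<epsilon> * norm (z - y)"
  proof -
    have "\<forall>\<^sub>F k in sequentially. dist (weighted_hessian f (w k) xs) H < \<epsilon> / (2 * K)"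
      using lim_xs \<epsilon>(1) K(1) by (intro tendstoD) auto
    then show ?thesis
    proof eventually_elim
      case (elim k)
      define W where "W = weighted_hessian f (w k) xs"
      show ?case
      proof (intro ballI)
        fix y z
        assume yz: "y \<in> ball xs \<delta>" "z \<in> ball xs \<delta>"
        have split: "G k z - G k y - H *v (z - y) =
            (G k z - G k y - W *v (z - y)) + (W - H) *v (z - y)"
          by (simp add: matrix_vector_mult_diff_rdistrib)
        have "norm (W - H) * K \<le> \<epsilon> / 2"
          using elim K(1) by (simp add: W_def dist_norm field_simps)
        then have "norm (W - H) * K * norm (z - y) \<le> \<epsilon> / 2 * norm (z - y)"
          by (rule mult_right_mono) simp
        then have "norm ((W - H) *v (z - y)) \<le> \<epsilon> / 2 * norm (z - y)"
          using K(2)[of "W - H" "z - y"] by (simp add: mult.commute mult.left_commute)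
        moreover have "norm (G k z - G k y - W *v (z - y)) \<le> \<epsilon> / 2 * norm (z - y)"
          unfolding W_def by (rule \<delta>(2)[OF yz])
        ultimately show "norm (G k z - G k y - H *v (z - y)) \<le> \<epsilon> * norm (z - y)"
          using norm_triangle_ineq[of "G k z - G k y - W *v (z - y)" "(W - H) *v (z - y)"]
          unfolding split by linarith
      qed
    qed
  qed

  have ev_x: "\<forall>\<^sub>F k in sequentially. x k \<in> ball xs \<delta>"
    using tendstoD[OF a_lim \<delta>(1)] by (simp add: dist_commute)
  then have ev_Suc: "\<forall>\<^sub>F k in sequentially. x (Suc k) \<in> ball xs \<delta>"
    by (subst eventually_sequentially_Suc)
  from ev_B ev_G ev_x ev_Suc b_unit
  show "\<forall>\<^sub>F k in sequentially. norm (x (Suc k) - xs) \<le> \<epsilon>\<^sub>0 * norm (x (Suc k) - x k)"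
  proof eventually_elim
    case (elim k)
    have d: "d k = s k" "x k + d k = x (Suc k)"
      using step[of k] elim(5) by (simp_all add: s_def)
    define \<phi> where "\<phi> y = (\<Sum>i\<in>UNIV. w k $ i * f i y)" for y
    define v where "v = G k (x k) + B k *v s k"
    note below = objective_le_imp_weighted_le[where f = f and g = g and w = "w k" and z = xs
        and y = "x (Suc k)", OF g(1) w_nonneg a_below x_dom]
    have "(\<Sum>i\<in>UNIV. w k $ i * real_of_ereal (g i (x (Suc k))))
         - (\<Sum>i\<in>UNIV. w k $ i * real_of_ereal (g i xs)) \<le> v \<bullet> (xs - x (Suc k))"
      unfolding v_def G_def w_def d(1)[symmetric] d(2)[symmetric]
    proof (rule inner_minimizer_variational_inequality[where g = g, OF g(1,2)])
      show "x k + d k \<in> (\<Inter>i. effective_domain (g i))"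
        unfolding d(2) by (rule x_dom)
      show "is_arg_min (inner_objective f g (\<alpha> k) (B k) (x k) (l k)) (\<lambda>_. True) (d k)"
        using l_dual by (simp add: dual_multiplier_def)
    qed (use w_nonneg[of k] B_pd x_dom[of k] below(1) in \<open>simp_all add: w_def\<close>)
    with below(2) have upper: "\<phi> xs - \<phi> (x (Suc k)) \<le> v \<bullet> (xs - x (Suc k))"
      by (simp add: \<phi>_def)
    have "(a / 2 - \<epsilon>) * norm (xs - x (Suc k)) \<le> norm (v - G k (x (Suc k)))"
    proof (rule error_le_residual[where S = "ball xs \<delta>" and H = H])
      show "(\<phi> has_derivative (\<lambda>h. G k u \<bullet> h)) (at u)" for u
        unfolding \<phi>_def G_def by (rule has_derivative_weighted_sum[OF f])
      show "a * (norm u)\<^sup>2 \<le> u \<bullet> (H *v u)" for u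
        using d_bounds(1) by (rule loewner_lower_bound_quadratic_form)
    qed (use elim(2,4) \<delta>(1) \<epsilon>(1) upper in auto)
    also have "v - G k (x (Suc k)) =
        (B k *v s k - H *v s k) - (G k (x (Suc k)) - G k (x k) - H *v s k)"
      by (simp add: v_def)
    also have "norm \<dots> \<le> norm (B k *v s k - H *v s k)
        + norm (G k (x (Suc k)) - G k (x k) - H *v s k)"
      by (rule norm_triangle_ineq4)
    also have "\<dots> \<le> \<epsilon> * norm (s k) + \<epsilon> * norm (s k)"
      using elim(1) elim(2)[rule_format, OF elim(3,4)] unfolding s_def by (rule add_mono)
    finally have main: "(a / 2 - \<epsilon>) * norm (xs - x (Suc k)) \<le> 2 * \<epsilon> * norm (s k)"
      by simp
    have "a / 4 * norm (xs - x (Suc k)) \<le> (a / 2 - \<epsilon>) * norm (xs - x (Suc k))"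
      using \<epsilon>(2) by (intro mult_right_mono) auto
    also note main
    also have "2 * \<epsilon> * norm (s k) \<le> a / 4 * (\<epsilon>\<^sub>0 * norm (s k))"
      using mult_right_mono[OF \<epsilon>(3), of "norm (s k)"] by simp
    finally show ?case
      using \<open>0 < a\<close> by (simp add: s_def norm_minus_commute)
  qed
qed

end
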